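(* In general, $\rho^{\rm o}(G\,\square\, K_2)$ can be arbitrarily larger than $2\rho_2(G)$: for every integer $m\ge 1$ there exists a finite graph $G$ such that $\rho^{\rm o}(G\,\square\, K_2)-2\rho_2(G)\ge m$.
   Context: Graphs are finite, simple and undirected. For a vertex $x$ of a graph $G$, $N(x)$ is the set of vertices adjacent to $x$ and $N[x]=N(x)\cup\{x\}$. A set $X\subseteq V(G)$ is a $2$-packing of $G$ if $N[x]\cap N[y]=\emptyset$ for every pair of distinct $x,y\in X$; $\rho_2(G)$ is the maximum cardinality of a $2$-packing of $G$. A set $X\subseteq V(G)$ is an open packing of $G$ if $N(x)\cap N(y)=\emptyset$ for every pair of distinct $x,y\in X$ (two vertices of an open packing may be adjacent); $\rho^{\rm o}(G)$ is the maximum cardinality of an open packing of $G$. The Cartesian product $G\,\square\, H$ has vertex set $V(G)\times V(H)$, with $(g_1,h_1)$ and $(g_2,h_2)$ adjacent if either $g_1=g_2$ and $h_1h_2\in E(H)$, or $h_1=h_2$ and $g_1g_2\in E(G)$. $K_2$ is the complete graph on two vertices. *)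

theory Defs
  imports "Graph_Theory.Graph_Theory"
begin

text \<open>
  Finite simple undirected graphs are the records \<^typ>\<open>'a pair_pre_digraph\<close> that satisfy
  \<^locale>\<open>pair_graph\<close>: finite, loop-free, and with a symmetric set of arcs, so that an edge
  \<open>uv\<close> is represented by the two arcs \<open>(u, v)\<close> and \<open>(v, u)\<close>.
\<close>

definition open_nbhd :: "'a pair_pre_digraph \<Rightarrow> 'a \<Rightarrow> 'a set" where
  "open_nbhd G x = {y. (x, y) \<in> parcs G}"

definition closed_nbhd :: "'a pair_pre_digraph \<Rightarrow> 'a \<Rightarrow> 'a set" where
  "closed_nbhd G x = open_nbhd G x \<union> {x}"

definition two_packing :: "'a pair_pre_digraph \<Rightarrow> 'a set \<Rightarrow> bool" where
  "two_packing G X \<longleftrightarrow> X \<subseteq> pverts G \<and>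
     (\<forall>x\<in>X. \<forall>y\<in>X. x \<noteq> y \<longrightarrow> closed_nbhd G x \<inter> closed_nbhd G y = {})"

definition open_packing :: "'a pair_pre_digraph \<Rightarrow> 'a set \<Rightarrow> bool" where
  "open_packing G X \<longleftrightarrow> X \<subseteq> pverts G \<and>
     (\<forall>x\<in>X. \<forall>y\<in>X. x \<noteq> y \<longrightarrow> open_nbhd G x \<inter> open_nbhd G y = {})"

text \<open>
  For a finite graph, the maxima below are over finite nonempty sets (the empty set is always a
  packing). For an infinite vertex set they may be meaningless.
\<close>

definition two_packing_number :: "'a pair_pre_digraph \<Rightarrow> nat" where
  "two_packing_number G = Max (card ` {X. two_packing G X})"

definition open_packing_number :: "'a pair_pre_digraph \<Rightarrow> nat" where
  "open_packing_number G = Max (card ` {X. open_packing G X})"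

definition cartesian_product ::
  "'a pair_pre_digraph \<Rightarrow> 'b pair_pre_digraph \<Rightarrow> ('a \<times> 'b) pair_pre_digraph" where
  "cartesian_product G H =
     \<lparr> pverts = pverts G \<times> pverts H,
       parcs = {((g1, h1), (g2, h2)) | g1 h1 g2 h2.
                 (g1 = g2 \<and> g1 \<in> pverts G \<and> (h1, h2) \<in> parcs H) \<or>
                 (h1 = h2 \<and> h1 \<in> pverts H \<and> (g1, g2) \<in> parcs G)} \<rparr>"

definition K2 :: "bool pair_pre_digraph" where
  "K2 = \<lparr> pverts = UNIV, parcs = {(u, v). u \<noteq> v} \<rparr>"

lemma pair_graph_K2: "pair_graph K2"
  by unfold_locales (auto simp: K2_def symmetric_def sym_def)

lemma complete_digraph_K2: "complete_digraph 2 (with_proj K2)"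
  unfolding complete_digraph_pair_def by (auto simp: K2_def)

lemma pair_graph_cartesian_product:
  assumes "pair_graph G" and "pair_graph H"
  shows "pair_graph (cartesian_product G H)"
proof -
  interpret G: pair_graph G by fact
  interpret H: pair_graph H by fact
  have sub: "parcs (cartesian_product G H) \<subseteq>
      (pverts G \<times> pverts H) \<times> (pverts G \<times> pverts H)"
    by (auto simp: cartesian_product_def
        dest: G.in_arcsD1 G.in_arcsD2 H.in_arcsD1 H.in_arcsD2)
  have fin: "finite (parcs (cartesian_product G H))"
    by (rule finite_subset[OF sub]) (simp add: G.pair_finite_verts H.pair_finite_verts)
  have symG: "(v, u) \<in> parcs G" if "(u, v) \<in> parcs G" for u v
    using G.pair_sym_arcs that by (auto simp: symmetric_def dest: symD)
  have symH: "(v, u) \<in> parcs H" if "(u, v) \<in> parcs H" for u v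
    using H.pair_sym_arcs that by (auto simp: symmetric_def dest: symD)
  show ?thesis
  proof
    show "fst e \<in> pverts (cartesian_product G H)"
      if "e \<in> parcs (cartesian_product G H)" for e
      using subsetD[OF sub that] by (auto simp: cartesian_product_def)
    show "snd e \<in> pverts (cartesian_product G H)"
      if "e \<in> parcs (cartesian_product G H)" for e
      using subsetD[OF sub that] by (auto simp: cartesian_product_def)
    show "finite (pverts (cartesian_product G H))"
      by (simp add: cartesian_product_def G.pair_finite_verts H.pair_finite_verts)
    show "finite (parcs (cartesian_product G H))" by (fact fin)
    show "fst e \<noteq> snd e" if "e \<in> parcs (cartesian_product G H)" for e
      using that by (auto simp: cartesian_product_def dest: G.pair_no_loops H.pair_no_loops)
    show "symmetric (with_proj (cartesian_product G H))"
      by (auto simp: symmetric_def sym_def cartesian_product_def intro: symG symH)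
  qed
qed

lemma finite_packings:
  assumes "finite (pverts G)"
  shows "finite {X. two_packing G X}" and "finite {X. open_packing G X}"
  by (rule finite_subset[of _ "Pow (pverts G)"];
      auto simp: two_packing_def open_packing_def assms)+

lemma packing_empty: "two_packing G {}" "open_packing G {}"
  by (auto simp: two_packing_def open_packing_def)

end

(* The 5-cycle has diameter 2, so a 2-packing has at most one vertex in each copy of it. In its
   prism, however, two adjacent vertices of one layer and the vertex opposite to them in the other
   layer form an open packing. Hence m disjoint copies of the 5-cycle give at least
   3m - 2m = m. *)
theory Submission
  imports Defs
begin

definition c5_adj :: "nat \<Rightarrow> nat \<Rightarrow> bool" where
  "c5_adj r s \<longleftrightarrow> s = Suc r mod 5 \<or> r = Suc s mod 5"

text \<open>Vertex \<open>5 * k + r\<close> with \<open>r < 5\<close> is the vertex \<open>r\<close> of the \<open>k\<close>-th copy of the cycle.\<close>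

definition c5_copies :: "nat \<Rightarrow> nat pair_pre_digraph" where
  "c5_copies n = \<lparr> pverts = {..<5 * n},
     parcs = {(x, y). x < 5 * n \<and> y < 5 * n \<and> x div 5 = y div 5 \<and> c5_adj (x mod 5) (y mod 5)} \<rparr>"

lemma less_5_cases:
  fixes r :: nat
  assumes "r < 5"
  obtains "r = 0" | "r = 1" | "r = 2" | "r = 3" | "r = 4"
  using assms by linarith

lemma c5_adj_irrefl: "\<not> c5_adj (x mod 5) (x mod 5)"
  by (rule less_5_cases[of "x mod 5"]) (simp_all add: c5_adj_def)

lemma c5_adj_sym: "c5_adj r s \<Longrightarrow> c5_adj s r"
  by (auto simp: c5_adj_def)

text \<open>Any two vertices of the 5-cycle are equal, adjacent or joined through a common
  neighbour, so their closed neighbourhoods meet; \<open>t\<close> is a common element.\<close>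

lemma c5_diameter_2:
  assumes "r < 5" "s < 5"
  shows "\<exists>t<5. (t = r \<or> c5_adj r t) \<and> (t = s \<or> c5_adj s t)"
proof -
  \<comment> \<open>An explicit set of candidates for \<open>t\<close> lets \<open>simp\<close>
    decide each of the 25 cases by evaluation.\<close>
  have "\<exists>t\<in>{0, 1, 2, 3, 4}. (t = r \<or> c5_adj r t) \<and> (t = s \<or> c5_adj s t)"
    by (rule less_5_cases[OF assms(1)]; rule less_5_cases[OF assms(2)];
        simp add: c5_adj_def)
  then obtain t where t: "t \<in> {0, 1, 2, 3, 4}" "(t = r \<or> c5_adj r t) \<and> (t = s \<or> c5_adj s t)" ..
  have "t < 5"
    using t(1) by auto
  with t(2) show ?thesis
    by blast
qed

lemma pair_graph_c5_copies: "pair_graph (c5_copies n)"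
proof
  show "finite (parcs (c5_copies n))"
    by (rule finite_subset[of _ "{..<5 * n} \<times> {..<5 * n}"]) (auto simp: c5_copies_def)
qed (auto simp: c5_copies_def c5_adj_irrefl symmetric_def sym_def c5_adj_sym)

lemma two_packing_number_c5_copies_le: "two_packing_number (c5_copies n) \<le> n"
proof -
  have "card X \<le> n" if X: "two_packing (c5_copies n) X" for X
  proof -
    have sub: "X \<subseteq> {..<5 * n}"
      using X by (simp add: two_packing_def c5_copies_def)
    \<comment> \<open>\<open>x div 5\<close> is the index of the copy containing \<open>x\<close>,
      so injectivity bounds \<open>card X\<close> by the number of copies.\<close>
    have "inj_on (\<lambda>x. x div 5) X"
    proof (rule inj_onI, rule ccontr)
      fix x y
      assume xy: "x \<in> X" "y \<in> X" "x div 5 = y div 5" "x \<noteq> y"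
      obtain t where t: "t < 5" "t = x mod 5 \<or> c5_adj (x mod 5) t"
        "t = y mod 5 \<or> c5_adj (y mod 5) t"
        using c5_diameter_2[of "x mod 5" "y mod 5"] by auto
      \<comment> \<open>The common closed neighbour \<open>t\<close> of the two residues, moved into
        the copy that contains both \<open>x\<close> and \<open>y\<close>.\<close>
      let ?z = "5 * (x div 5) + t"
      have less: "x < 5 * n" "y < 5 * n"
        using sub xy by auto
      have "x div 5 < n"
        using less(1) by auto
      then have z: "?z < 5 * n" "?z div 5 = x div 5" "?z mod 5 = t"
        using t(1) by (linarith, simp_all)
      have "?z \<in> closed_nbhd (c5_copies n) w"
        if w: "w < 5 * n" "w div 5 = x div 5" "t = w mod 5 \<or> c5_adj (w mod 5) t" for w
        using w(3)
      proof
        assume "t = w mod 5"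
        then have "?z = w"
          by (simp flip: w(2))
        then show ?thesis
          by (simp add: closed_nbhd_def)
      next
        assume "c5_adj (w mod 5) t"
        then show ?thesis
          using z w(1,2) by (simp add: closed_nbhd_def open_nbhd_def c5_copies_def)
      qed
      then have "?z \<in> closed_nbhd (c5_copies n) x" "?z \<in> closed_nbhd (c5_copies n) y"
        using less t(2,3) xy(3) by simp_all
      then show False
        using X xy by (auto simp: two_packing_def)
    qed
    moreover have "(\<lambda>x. x div 5) ` X \<subseteq> {..<n}"
      using sub by auto
    ultimately show ?thesis
      using card_inj_on_le[of "\<lambda>x. x div 5" X "{..<n}"] by simp
  qed
  \<comment> \<open>\<open>Max\<close> is controlled only over a finite nonempty set; the empty
    packing supplies nonemptiness.\<close>
  moreover have "finite {X. two_packing (c5_copies n) X}"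
    by (rule finite_packings) (simp add: c5_copies_def)
  ultimately show ?thesis
    unfolding two_packing_number_def using packing_empty(1) by (subst Max_le_iff) auto
qed

lemma open_packing_number_c5_prism_ge:
  "3 * n \<le> open_packing_number (cartesian_product (c5_copies n) K2)"
proof -
  let ?P = "cartesian_product (c5_copies n) K2"
  \<comment> \<open>The open neighbourhoods of these three vertices in one prism are {(1, False),
    (4, False), (0, True)}, {(0, False), (2, False), (1, True)} and {(2, True), (4, True), (3,
    False)}, which are pairwise disjoint.\<close>
  let ?S = "{(0, False), (1, False), (3, True)} :: (nat \<times> bool) set"
  let ?f = "\<lambda>(k, r, b). (5 * k + r, b)"
  let ?X = "?f ` ({..<n} \<times> ?S)"
  have inj: "inj_on ?f ({..<n} \<times> ?S)"
    by (rule inj_onI) (auto, presburger+)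
  have "card ?X = card ({..<n} \<times> ?S)"
    by (rule card_image[OF inj])
  then have "card ?X = 3 * n"
    by (simp add: card_cartesian_product)
  moreover have "open_packing ?P ?X"
    unfolding open_packing_def
  proof (intro conjI ballI impI)
    show "?X \<subseteq> pverts ?P"
      by (auto simp: cartesian_product_def c5_copies_def K2_def)
  next
    fix x y
    assume "x \<in> ?X" "y \<in> ?X" and ne: "x \<noteq> y"
    then obtain k r b l s c where x: "x = (5 * k + r, b)" "(r, b) \<in> ?S"
      and y: "y = (5 * l + s, c)" "(s, c) \<in> ?S"
      by fast
    \<comment> \<open>A step in the prism stays in its copy: it either follows a cycle edge within
      the layer or switches layer and keeps the residue. Membership in \<open>?S\<close> gives r <
      5, so \<open>div\<close> and \<open>mod\<close> recover k and r.\<close>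
    have nbhd: "u div 5 = k \<and> (if d = b then c5_adj r (u mod 5) else u mod 5 = r)"
      if "(u, d) \<in> open_nbhd ?P (5 * k + r, b)" "(r, b) \<in> ?S" for u d k r b
      using that by (auto simp: open_nbhd_def cartesian_product_def c5_copies_def K2_def)
    have disjoint: False
      if "t < 5" "(r, b) \<in> ?S" "(s, c) \<in> ?S" "(r, b) \<noteq> (s, c)"
        "if d = b then c5_adj r t else t = r" "if d = c then c5_adj s t else t = s"
      for t r b s c d
      using that(1) by (rule less_5_cases) (use that(2-) in \<open>auto simp: c5_adj_def split: if_splits\<close>)
    show "open_nbhd ?P x \<inter> open_nbhd ?P y = {}"
    proof (rule ccontr)
      assume "open_nbhd ?P x \<inter> open_nbhd ?P y \<noteq> {}"
      then obtain u d where u: "(u, d) \<in> open_nbhd ?P x" "(u, d) \<in> open_nbhd ?P y"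
        by fast
      have 1: "u div 5 = k" "if d = b then c5_adj r (u mod 5) else u mod 5 = r"
        using nbhd u(1) x by auto
      have 2: "u div 5 = l" "if d = c then c5_adj s (u mod 5) else u mod 5 = s"
        using nbhd u(2) y by auto
      \<comment> \<open>A common neighbour forces k = l, so \<open>x\<close> and \<open>y\<close>
        can only differ in their \<open>?S\<close> part, which reduces the claim to a single
        prism.\<close>
      have "(r, b) \<noteq> (s, c)"
        using ne x y 1(1) 2(1) by auto
      then show False
        using disjoint[of "u mod 5"] x(2) y(2) 1(2) 2(2) by simp
    qed
  qed
  moreover have "finite {X. open_packing ?P X}"
    by (rule finite_packings) (simp add: cartesian_product_def c5_copies_def K2_def)
  then have "Max (card ` {X. open_packing ?P X}) \<ge> card X" if "open_packing ?P X" for X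
    using that by (intro Max_ge) simp_all
  ultimately show ?thesis
    unfolding open_packing_number_def by metis
qed

theorem mainTheorem5:
  fixes m :: int
  assumes "m \<ge> 1"
  shows "\<exists>G :: nat pair_pre_digraph. pair_graph G \<and>
    int (open_packing_number (cartesian_product G K2)) - 2 * int (two_packing_number G) \<ge> m"
proof (intro exI conjI)
  show "pair_graph (c5_copies (nat m))"
    by (rule pair_graph_c5_copies)
  show "int (open_packing_number (cartesian_product (c5_copies (nat m)) K2))
      - 2 * int (two_packing_number (c5_copies (nat m))) \<ge> m"
    using two_packing_number_c5_copies_le[of "nat m"] open_packing_number_c5_prism_ge[of "nat m"]
      assms by linarith
qed

end
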